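(* Let $G$ be a finite abelian group and $H$ a subgroup of $G$. Then for every $h \in H$ there exists a homogeneous polynomial $A_{h} \in \mathbb{C}[x_{g}]$ with $\deg A_{h} = [G : H]$ such that $$ \Theta(G) = \prod_{\chi \in \widehat{H}} \sum_{h \in H} \chi(h) A_{h} . $$ Moreover, if $H = G$, we can take $A_{h} = x_{h}$ for each $h \in H$.
   Context: For a finite group $G$, $\{x_{g} \mid g \in G\}$ is a family of independent commuting variables indexed by $G$, and $\mathbb{C}[x_{g}] = \mathbb{C}[x_{g}; g \in G]$ is the polynomial ring in these variables over $\mathbb{C}$. The group determinant of $G$ is $\Theta(G) = \det\left(x_{gh^{-1}}\right)_{g,h \in G} \in \mathbb{C}[x_{g}]$, the determinant of the matrix with rows and columns indexed by the elements of $G$ (in the same, arbitrary, ordering). $[G:H]$ is the index of $H$ in $G$. For a finite abelian group $H$, the dual group $\widehat{H}$ is the group of characters of $H$, i.e. of group homomorphisms $H \to \mathbb{C}^{\times}$. *)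

theory Defs
  imports
    "HOL-Library.Poly_Mapping"
    "HOL-Algebra.Coset"
    "Jordan_Normal_Form.Determinant"
begin

text \<open>
  Polynomials over \<open>\<complex>\<close> in variables indexed by a type are finitely supported functions from
  monomials (finitely supported exponent functions) to coefficients; the ring structure
  (convolution product) is the one of \<open>HOL-Library.Poly_Mapping\<close>.
\<close>

type_synonym 'x cpoly = "('x \<Rightarrow>\<^sub>0 nat) \<Rightarrow>\<^sub>0 complex"

definition Var :: "'x \<Rightarrow> 'x cpoly" where
  "Var x = Poly_Mapping.single (Poly_Mapping.single x 1) 1"

definition Const :: "complex \<Rightarrow> 'x cpoly" where
  "Const c = Poly_Mapping.single 0 c"

definition poly_ring :: "'x set \<Rightarrow> 'x cpoly set" where
  "poly_ring X = {p. \<forall>m \<in> Poly_Mapping.keys p. Poly_Mapping.keys m \<subseteq> X}"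

definition monom_degree :: "('x \<Rightarrow>\<^sub>0 nat) \<Rightarrow> nat" where
  "monom_degree m = (\<Sum>x \<in> Poly_Mapping.keys m. Poly_Mapping.lookup m x)"

text \<open>The zero polynomial gets total degree 0, so a positive total degree implies being nonzero.\<close>

definition total_degree :: "'x cpoly \<Rightarrow> nat" where
  "total_degree p = Max (insert 0 (monom_degree ` Poly_Mapping.keys p))"

definition homogeneous :: "'x cpoly \<Rightarrow> bool" where
  "homogeneous p \<longleftrightarrow> (\<exists>d. \<forall>m \<in> Poly_Mapping.keys p. monom_degree m = d)"

definition group_matrix :: "('a, 'b) monoid_scheme \<Rightarrow> 'a list \<Rightarrow> 'a cpoly mat" where
  "group_matrix G gs =
     mat (length gs) (length gs) (\<lambda>(i, j). Var (gs ! i \<otimes>\<^bsub>G\<^esub> inv\<^bsub>G\<^esub> (gs ! j)))"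

text \<open>
  The determinant is taken with respect to some enumeration of the (finite) carrier; by
  \<open>group_det_eq\<close> below every enumeration gives the same value.
\<close>

definition group_det :: "('a, 'b) monoid_scheme \<Rightarrow> 'a cpoly" where
  "group_det G = det (group_matrix G (SOME gs. distinct gs \<and> set gs = carrier G))"

lemma det_group_matrix_cong:
  assumes "distinct gs" "distinct hs" "set gs = set hs"
  shows "det (group_matrix G gs) = det (group_matrix G hs)"
proof -
  have "mset gs = mset hs"
    using assms set_eq_iff_mset_eq_distinct by blast
  then obtain p where p: "p permutes {..<length hs}" and gs: "permute_list p hs = gs"
    by (rule mset_eq_permutation)
  define n where "n = length hs"
  define A where "A = group_matrix G hs"
  define B where "B = mat n n (\<lambda>(i, j). A $$ (p i, j))"
  have len: "length gs = n"
    using gs by (auto simp: n_def)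
  have p': "p permutes {0..<n}"
    using p by (simp add: n_def lessThan_atLeast0)
  have p_lt: "p i < n" if "i < n" for i
    using permutes_in_image[OF p', of i] that by simp
  have nth: "gs ! i = hs ! p i" if "i < n" for i
    using that permute_list_nth[OF p, of i] gs by (simp add: n_def)
  have A: "A \<in> carrier_mat n n" and B: "B \<in> carrier_mat n n"
    by (auto simp: A_def B_def group_matrix_def n_def)
  have "group_matrix G gs = transpose_mat (mat n n (\<lambda>(i, j). transpose_mat B $$ (p i, j)))"
    using len nth p_lt by (intro eq_matI) (auto simp: group_matrix_def A_def B_def n_def)
  then have "det (group_matrix G gs) = det (mat n n (\<lambda>(i, j). transpose_mat B $$ (p i, j)))"
    by (simp add: det_transpose[of _ n])
  also have "\<dots> = signof p * det B"
    using B by (simp add: det_permute_rows[OF _ p'] det_transpose[of _ n])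
  also have "det B = signof p * det A"
    unfolding B_def by (rule det_permute_rows[OF A p'])
  finally show ?thesis
    by (auto simp: A_def sign_def)
qed

lemma group_det_eq:
  assumes "distinct gs" "set gs = carrier G"
  shows "group_det G = det (group_matrix G gs)"
proof -
  let ?hs = "SOME hs. distinct hs \<and> set hs = carrier G"
  have "distinct ?hs \<and> set ?hs = carrier G"
    by (rule someI[of _ gs]) (use assms in simp)
  then show ?thesis
    unfolding group_det_def using assms by (intro det_group_matrix_cong) auto
qed

definition complex_units :: "complex monoid" where
  "complex_units = \<lparr>carrier = UNIV - {0}, monoid.mult = (*), one = 1\<rparr>"

text \<open>
  Restricting to functions that are \<open>undefined\<close> outside the carrier makes the elements of the set
  correspond one-to-one to the characters, so that products over it count every character once.
\<close>

definition dual_group :: "('a, 'b) monoid_scheme \<Rightarrow> ('a \<Rightarrow> complex) set" where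
  "dual_group H = hom H complex_units \<inter> extensional (carrier H)"

end

theory Submission
  imports Defs "HOL-Algebra.Multiplicative_Group"
begin

text \<open>
  By Dedekind, the group determinant of a finite abelian group \<open>G\<close> splits into linear factors: the
  row vector of values of a character \<open>\<chi>\<close> is an eigenvector of the group matrix with eigenvalue
  \<open>L\<^sub>\<chi> = (\<Sum>g. \<chi>(g) x\<^sub>g)\<close>, and there are as many characters as group elements
  (\<open>dedekind_group_det\<close>). Grouping these factors by the restriction of \<open>\<chi>\<close> to the subgroup \<open>H\<close>
  gives \<open>\<Theta>(G) = (\<Prod>\<psi>. P\<^sub>\<psi>)\<close>, where \<open>\<psi>\<close> runs over the characters of \<open>H\<close> and \<open>P\<^sub>\<psi>\<close>
  is the product of the \<open>L\<^sub>\<chi>\<close> with \<open>\<chi>\<close> extending \<open>\<psi>\<close>. Every \<open>\<psi>\<close> has exactly \<open>[G : H]\<close>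
  extensions (\<open>card_extensions_index\<close>), so \<open>P\<^sub>\<psi>\<close> is a form of degree \<open>[G : H]\<close>.

  Any family indexed by the characters of \<open>H\<close> is the Fourier transform of a family indexed by
  \<open>H\<close>. Fourier inversion therefore dictates
  \<open>A\<^sub>h = (\<Sum>\<psi>. \<psi>(h\<inverse>) P\<^sub>\<psi>) / |H|\<close>, which satisfies
  \<open>(\<Sum>h. \<psi>(h) A\<^sub>h) = P\<^sub>\<psi>\<close> by orthogonality of characters (\<open>relative_factor_expansion\<close>)
  and is again a form of degree \<open>[G : H]\<close>.

  What remains is that \<open>A\<^sub>h\<close> is not the zero polynomial, since otherwise its degree would not be
  \<open>[G : H]\<close>. Specialise \<open>x\<^sub>g\<close> to \<open>1\<close> for \<open>g \<in> H\<close> and to \<open>0\<close> elsewhere: then \<open>L\<^sub>\<chi>\<close>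
  becomes the sum of the values of \<open>\<chi>\<close> on \<open>H\<close>, only the trivial \<open>\<psi>\<close> survives, and \<open>A\<^sub>h\<close> takes
  the value \<open>|H|\<close> to the power \<open>[G : H] - 1\<close> (\<open>relative_coeff_nonzero\<close>).
  For \<open>H = G\<close> Dedekind's factorisation is already of the required form with \<open>A\<^sub>h = x\<^sub>h\<close>.
\<close>

section \<open>Characters of finite abelian groups\<close>

lemma dual_group_subgroup_iff:
  "\<chi> \<in> dual_group (G\<lparr>carrier := K\<rparr>) \<longleftrightarrow>
     \<chi> \<in> extensional K \<and> (\<forall>x\<in>K. \<chi> x \<noteq> 0) \<and> (\<forall>x\<in>K. \<forall>y\<in>K. \<chi> (x \<otimes>\<^bsub>G\<^esub> y) = \<chi> x * \<chi> y)"
  by (auto simp: dual_group_def hom_def complex_units_def)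

lemma dual_group_iff:
  "\<chi> \<in> dual_group G \<longleftrightarrow>
     \<chi> \<in> extensional (carrier G) \<and> (\<forall>x\<in>carrier G. \<chi> x \<noteq> 0) \<and>
     (\<forall>x\<in>carrier G. \<forall>y\<in>carrier G. \<chi> (x \<otimes>\<^bsub>G\<^esub> y) = \<chi> x * \<chi> y)"
  by (auto simp: dual_group_def hom_def complex_units_def)

lemma (in group) character_one:
  assumes "\<chi> \<in> dual_group G"
  shows "\<chi> \<one> = 1"
  using assms unfolding dual_group_iff by (metis mult_cancel_left1 one_closed r_one)

lemma (in group) character_inv:
  assumes "\<chi> \<in> dual_group G" "x \<in> carrier G"
  shows "\<chi> (inv x) = inverse (\<chi> x)"
proof -
  have "\<chi> x * \<chi> (inv x) = 1"
    using assms character_one[OF assms(1)] unfolding dual_group_iff by (metis inv_closed r_inv)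
  then show ?thesis by (simp add: inverse_unique)
qed

lemma (in group) character_pow:
  assumes "\<chi> \<in> dual_group G" "x \<in> carrier G"
  shows "\<chi> (x [^] (k::nat)) = \<chi> x ^ k"
  using assms character_one[OF assms(1)]
  by (induction k) (auto simp: dual_group_iff)

lemma (in group) character_restrict:
  assumes "subgroup H G" "\<chi> \<in> dual_group G"
  shows "restrict \<chi> H \<in> dual_group (G\<lparr>carrier := H\<rparr>)"
  using assms subgroup.subset[OF assms(1)] subgroup.m_closed[OF assms(1)]
  unfolding dual_group_subgroup_iff dual_group_iff by (auto simp: subset_iff)

text \<open>
  Translating the summation variable by \<open>k\<close> multiplies the sum by \<open>\<chi>(k) \<psi>(k)\<inverse>\<close>. If \<open>\<chi>\<close> and
  \<open>\<psi>\<close> differ at \<open>k\<close>, this factor is not \<open>1\<close> and the sum must vanish.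
\<close>

lemma (in group) character_orthogonality:
  assumes "finite (carrier G)" "\<chi> \<in> dual_group G" "\<psi> \<in> dual_group G"
  shows "(\<Sum>g\<in>carrier G. \<chi> g * \<psi> (inv g)) = (if \<chi> = \<psi> then of_nat (card (carrier G)) else 0)"
proof (cases "\<chi> = \<psi>")
  case True
  have "\<chi> g * \<psi> (inv g) = 1" if "g \<in> carrier G" for g
    using that assms True character_inv[of \<psi> g] by (auto simp: dual_group_iff)
  then show ?thesis using True by simp
next
  case False
  then obtain k where k: "k \<in> carrier G" "\<chi> k \<noteq> \<psi> k"
    using assms(2,3) unfolding dual_group_iff by (meson extensionalityI)
  let ?f = "\<lambda>g. \<chi> g * \<psi> (inv g)"
  have bij: "bij_betw (\<lambda>g. k \<otimes> g) (carrier G) (carrier G)"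
    using k(1) by (intro bij_betwI[where g = "\<lambda>g. inv k \<otimes> g"]) (auto simp: m_assoc[symmetric])
  have "sum ?f (carrier G) = (\<Sum>g\<in>carrier G. ?f (k \<otimes> g))"
    by (rule sum.reindex_bij_betw[OF bij, symmetric])
  also have "\<dots> = (\<Sum>g\<in>carrier G. \<chi> k * inverse (\<psi> k) * ?f g)"
    using assms k(1) character_inv[OF assms(3)]
    by (intro sum.cong) (auto simp: dual_group_iff inv_mult_group)
  also have "\<dots> = \<chi> k * inverse (\<psi> k) * sum ?f (carrier G)"
    by (simp add: sum_distrib_left)
  finally have eq: "sum ?f (carrier G) = \<chi> k * inverse (\<psi> k) * sum ?f (carrier G)" .
  have "\<chi> k * inverse (\<psi> k) \<noteq> 1"
    using k assms(3) by (auto simp: dual_group_iff field_simps)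
  with eq have "sum ?f (carrier G) = 0"
    by (metis mult_cancel_right1)
  then show ?thesis using False by simp
qed

section \<open>Counting the extensions of a character\<close>

text \<open>
  The subgroup generated by \<open>H\<close> and \<open>a\<close>. Natural exponents suffice when \<open>a\<close> has finite order, and
  with them the value of a character at \<open>h \<otimes> a [^] i\<close> is an ordinary power.
\<close>

definition (in comm_group) adjoin :: "'a set \<Rightarrow> 'a \<Rightarrow> 'a set" where
  "adjoin H a = (\<lambda>(h, i::nat). h \<otimes> a [^] i) ` (H \<times> UNIV)"

lemma (in comm_group) adjoinI:
  "h \<in> H \<Longrightarrow> h \<otimes> a [^] (i::nat) \<in> adjoin H a"
  by (force simp: adjoin_def)

lemma (in comm_group) adjoin_mult:
  assumes "subgroup H G" "a \<in> carrier G" "h \<in> H" "h' \<in> H"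
  shows "(h \<otimes> a [^] (i::nat)) \<otimes> (h' \<otimes> a [^] (j::nat)) = (h \<otimes> h') \<otimes> a [^] (i + j)"
  using assms subgroup.mem_carrier[OF assms(1)]
  by (simp add: m_ac nat_pow_mult[symmetric])

lemma (in comm_group) adjoin_subgroup:
  assumes "finite (carrier G)" "subgroup H G" "a \<in> carrier G"
  shows "subgroup (adjoin H a) G" "H \<subseteq> adjoin H a" "a \<in> adjoin H a"
proof -
  note H = subgroup.mem_carrier[OF assms(2)] subgroup.m_closed[OF assms(2)]
    subgroup.one_closed[OF assms(2)] subgroup.m_inv_closed[OF assms(2)]
  show "H \<subseteq> adjoin H a"
    using adjoinI[of _ H a 0] H by auto
  show a: "a \<in> adjoin H a"
    using adjoinI[of \<one> H a 1] H assms(3) by simp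
  show "subgroup (adjoin H a) G"
  proof (rule subgroupI)
    show "adjoin H a \<subseteq> carrier G"
      using H assms(3) by (auto simp: adjoin_def)
    show "adjoin H a \<noteq> {}" using a by blast
    fix x assume "x \<in> adjoin H a"
    then obtain h and i :: nat where x: "x = h \<otimes> a [^] i" "h \<in> H" by (auto simp: adjoin_def)
    \<comment> \<open>the inverse of \<open>a\<close> is \<open>a\<close> to the power \<open>|G| - 1\<close>, so no negative exponent is needed\<close>
    have "a [^] i \<otimes> (a [^] (Coset.order G - 1)) [^] i = (a [^] Coset.order G) [^] i"
    proof -
      have "Coset.order G > 0" using assms(1) by (simp add: order_gt_0_iff_finite)
      then have "a [^] Coset.order G = a \<otimes> a [^] (Coset.order G - 1)"
        using assms(3) nat_pow_Suc2[OF assms(3), of "Coset.order G - 1"] by simp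
      then show ?thesis
        using assms(3) by (simp add: nat_pow_distrib)
    qed
    also have "\<dots> = \<one>"
      using assms(3) pow_order_eq_1 by simp
    finally have "inv (a [^] i) = a [^] ((Coset.order G - 1) * i)"
      using assms(3) inv_equality[of "a [^] ((Coset.order G - 1) * i)" "a [^] i"]
      by (simp add: nat_pow_pow m_comm)
    then have "inv x = inv h \<otimes> a [^] ((Coset.order G - 1) * i)"
      using x H assms(3) by (simp add: inv_mult)
    then show "inv x \<in> adjoin H a" using x H adjoinI by simp
    fix y assume "y \<in> adjoin H a"
    then obtain h' and j :: nat where y: "y = h' \<otimes> a [^] j" "h' \<in> H" by (auto simp: adjoin_def)
    show "x \<otimes> y \<in> adjoin H a"
      using x y H adjoin_mult[OF assms(2,3) x(2) y(2)] adjoinI by simp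
  qed
qed

text \<open>
  The order of \<open>a\<close> modulo \<open>H\<close>, that is, the order of the coset of \<open>a\<close> in the quotient group.
\<close>

definition (in comm_group) rel_order :: "'a set \<Rightarrow> 'a \<Rightarrow> nat" where
  "rel_order H a = (LEAST m. 0 < m \<and> a [^] m \<in> H)"

lemma (in comm_group) rel_order:
  assumes "finite (carrier G)" "subgroup H G" "a \<in> carrier G"
  shows "rel_order H a > 0" "a [^] rel_order H a \<in> H"
proof -
  have "0 < Coset.order G \<and> a [^] Coset.order G \<in> H"
    using assms pow_order_eq_1 subgroup.one_closed[OF assms(2)]
    by (simp add: order_gt_0_iff_finite)
  then have "0 < rel_order H a \<and> a [^] rel_order H a \<in> H"
    unfolding rel_order_def by (rule LeastI)
  then show "rel_order H a > 0" "a [^] rel_order H a \<in> H" by auto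
qed

lemma (in comm_group) rel_order_le:
  "0 < m \<Longrightarrow> a [^] m \<in> H \<Longrightarrow> rel_order H a \<le> m"
  unfolding rel_order_def by (rule Least_le) simp

lemma (in comm_group) rel_order_dvd:
  assumes "finite (carrier G)" "subgroup H G" "a \<in> carrier G" "a [^] (k::nat) \<in> H"
  shows "rel_order H a dvd k"
proof (rule ccontr)
  let ?m = "rel_order H a"
  note m = rel_order[OF assms(1-3)]
  note H = subgroup.mem_carrier[OF assms(2)] subgroup.m_closed[OF assms(2)]
    subgroup.one_closed[OF assms(2)] subgroup.m_inv_closed[OF assms(2)]
  have pw: "(a [^] ?m) [^] q \<in> H" for q :: nat
    using m(2) H by (induction q) auto
  assume "\<not> ?m dvd k"
  then have r: "0 < k mod ?m" by (simp add: mod_greater_zero_iff_not_dvd)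
  have "a [^] k = (a [^] ?m) [^] (k div ?m) \<otimes> a [^] (k mod ?m)"
    using assms(3) by (simp add: nat_pow_pow nat_pow_mult)
  then have "a [^] (k mod ?m) = inv ((a [^] ?m) [^] (k div ?m)) \<otimes> a [^] k"
    using assms(3) by (simp add: m_assoc[symmetric])
  also have "\<dots> \<in> H" using pw assms(4) H by blast
  finally have "?m \<le> k mod ?m"
    by (rule rel_order_le[OF r])
  moreover have "k mod ?m < ?m" using m by simp
  ultimately show False by simp
qed

text \<open>
  The representation \<open>h \<otimes> a [^] i\<close> of an element of \<open>adjoin H a\<close> is unique up to moving powers of
  \<open>a [^] rel_order H a\<close>, an element of \<open>H\<close>, between the two factors. This single ambiguity
  yields both the cardinality of \<open>adjoin H a\<close> and the condition for extending a character to it.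
\<close>

lemma (in comm_group) adjoin_eq_imp:
  assumes "finite (carrier G)" "subgroup H G" "a \<in> carrier G" "h \<in> H" "h' \<in> H"
    and eq: "h \<otimes> a [^] (i::nat) = h' \<otimes> a [^] (j::nat)" and "i \<le> j"
  obtains q where "j = i + rel_order H a * q" "h = h' \<otimes> (a [^] rel_order H a) [^] q"
proof -
  note H = subgroup.mem_carrier[OF assms(2)] subgroup.m_closed[OF assms(2)]
    subgroup.m_inv_closed[OF assms(2)]
  have "h \<otimes> a [^] i = (h' \<otimes> a [^] (j - i)) \<otimes> a [^] i"
    using eq assms H by (simp add: m_assoc nat_pow_mult)
  then have h: "h = h' \<otimes> a [^] (j - i)"
    using assms H by simp
  then have "a [^] (j - i) = inv h' \<otimes> h"
    using assms H by (simp add: m_assoc[symmetric])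
  then have "a [^] (j - i) \<in> H" using assms H by simp
  then obtain q where q: "j - i = rel_order H a * q"
    using rel_order_dvd[OF assms(1-3)] by blast
  show ?thesis
    using that[of q] q h assms by (simp add: nat_pow_pow)
qed

lemma (in comm_group) card_adjoin:
  assumes "finite (carrier G)" "subgroup H G" "a \<in> carrier G"
  shows "card (adjoin H a) = card H * rel_order H a"
proof -
  let ?m = "rel_order H a" and ?f = "\<lambda>(h, i::nat). h \<otimes> a [^] i"
  note m = rel_order[OF assms(1-3)]
  note H = subgroup.mem_carrier[OF assms(2)] subgroup.m_closed[OF assms(2)]
    subgroup.one_closed[OF assms(2)]
  have pw: "(a [^] ?m) [^] q \<in> H" for q :: nat
    using m(2) H by (induction q) auto
  have inj1: "h = h' \<and> i = j"
    if *: "h \<in> H" "h' \<in> H" "h \<otimes> a [^] i = h' \<otimes> a [^] j" "i \<le> j" "j < ?m" for h h' and i j :: nat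
  proof -
    obtain q where q: "j = i + ?m * q" "h = h' \<otimes> (a [^] ?m) [^] q"
      using adjoin_eq_imp[OF assms *(1-4)] by blast
    then have "q = 0" using * by (cases q) auto
    then show ?thesis using q * H by simp
  qed
  have "inj_on ?f (H \<times> {..<?m})"
  proof (rule inj_onI, clarify)
    fix h h' and i j :: nat
    assume *: "h \<in> H" "h' \<in> H" "i < ?m" "j < ?m" "h \<otimes> a [^] i = h' \<otimes> a [^] j"
    show "h = h' \<and> i = j"
      using inj1[of h h' i j] inj1[of h' h j i] * by (cases "i \<le> j") auto
  qed
  moreover have "adjoin H a = ?f ` (H \<times> {..<?m})"
  proof
    show "adjoin H a \<subseteq> ?f ` (H \<times> {..<?m})"
    proof
      fix x assume "x \<in> adjoin H a"
      then obtain h and i :: nat where x: "x = h \<otimes> a [^] i" "h \<in> H" by (auto simp: adjoin_def)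
      have "a [^] i = (a [^] ?m) [^] (i div ?m) \<otimes> a [^] (i mod ?m)"
        using assms(3) by (simp add: nat_pow_pow nat_pow_mult)
      then have "x = (h \<otimes> (a [^] ?m) [^] (i div ?m)) \<otimes> a [^] (i mod ?m)"
        using x assms(3) H by (simp add: m_assoc)
      moreover have "h \<otimes> (a [^] ?m) [^] (i div ?m) \<in> H" using x pw H by blast
      ultimately show "x \<in> ?f ` (H \<times> {..<?m})"
        using m by (intro image_eqI[where x = "(h \<otimes> (a [^] ?m) [^] (i div ?m), i mod ?m)"]) auto
    qed
  qed (auto simp: adjoin_def)
  ultimately show ?thesis
    by (simp add: card_image card_cartesian_product)
qed

text \<open>
  An extension \<open>\<chi>\<close> of \<open>\<psi>\<close> is determined by \<open>z = \<chi>(a)\<close>. With \<open>m = rel_order H a\<close>, the number \<open>z\<close>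
  must be an \<open>m\<close>-th root of \<open>c = \<psi>(a\<^sup>m)\<close>, and by \<open>adjoin_eq_imp\<close> this is all that is needed for
  \<open>h \<otimes> a [^] i \<mapsto> \<psi>(h) z\<^sup>i\<close> to be well defined. A nonzero complex number has exactly \<open>m\<close> such
  roots.
\<close>

lemma (in comm_group) card_extensions_adjoin:
  assumes "finite (carrier G)" "subgroup H G" "a \<in> carrier G"
    and \<psi>: "\<psi> \<in> dual_group (G\<lparr>carrier := H\<rparr>)"
  shows "card {\<chi> \<in> dual_group (G\<lparr>carrier := adjoin H a\<rparr>). restrict \<chi> H = \<psi>} = rel_order H a"
proof -
  let ?m = "rel_order H a" and ?K = "adjoin H a"
  define c where "c = \<psi> (a [^] ?m)"
  define E where "E = {\<chi> \<in> dual_group (G\<lparr>carrier := ?K\<rparr>). restrict \<chi> H = \<psi>}"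
  note m = rel_order[OF assms(1-3)]
  note H = subgroup.mem_carrier[OF assms(2)] subgroup.m_closed[OF assms(2)]
    subgroup.one_closed[OF assms(2)]
  note K = adjoin_subgroup[OF assms(1-3)]
  interpret GH: group "G\<lparr>carrier := H\<rparr>"
    using assms(2) by (rule subgroup.subgroup_is_group) (rule group_axioms)
  interpret GK: group "G\<lparr>carrier := ?K\<rparr>"
    using K(1) by (rule subgroup.subgroup_is_group) (rule group_axioms)
  have pwH: "\<psi> (x [^] k) = \<psi> x ^ k" if "x \<in> H" for x and k :: nat
    using GH.character_pow[OF \<psi>, of x k] that by (simp add: nat_pow_consistent[symmetric])
  have pwK: "\<chi> (x [^] k) = \<chi> x ^ k" if "x \<in> ?K" "\<chi> \<in> E" for \<chi> x and k :: nat
    using GK.character_pow[of \<chi> x k] that by (simp add: E_def nat_pow_consistent[symmetric])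
  have pw: "(a [^] ?m) [^] q \<in> H" for q :: nat
    using m(2) H by (induction q) auto
  have powK: "a [^] i \<in> ?K" for i :: nat
    using adjoinI[of \<one> H a i] H assms(3) by simp
  have \<psi>_mult: "\<psi> (x \<otimes> y) = \<psi> x * \<psi> y" if "x \<in> H" "y \<in> H" for x y
    using \<psi> that by (auto simp: dual_group_subgroup_iff)
  have E_eq: "\<chi> (h \<otimes> a [^] i) = \<psi> h * \<chi> a ^ i" if "\<chi> \<in> E" "h \<in> H" for \<chi> h and i :: nat
  proof -
    have "\<chi> (h \<otimes> a [^] i) = \<chi> h * \<chi> (a [^] i)"
      using that K powK by (auto simp: E_def dual_group_subgroup_iff)
    also have "\<chi> h = \<psi> h" using that by (auto simp: E_def)
    finally show ?thesis using pwK[OF K(3) that(1)] by simp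
  qed
  have "bij_betw (\<lambda>\<chi>. \<chi> a) E {z. z ^ ?m = c}"
    unfolding bij_betw_def
  proof
    show "inj_on (\<lambda>\<chi>. \<chi> a) E"
    proof (rule inj_onI)
      fix \<chi> \<phi> assume *: "\<chi> \<in> E" "\<phi> \<in> E" "\<chi> a = \<phi> a"
      show "\<chi> = \<phi>"
      proof (rule extensionalityI)
        show "\<chi> \<in> extensional ?K" "\<phi> \<in> extensional ?K"
          using * by (auto simp: E_def dual_group_subgroup_iff)
        fix x assume "x \<in> ?K"
        then show "\<chi> x = \<phi> x"
          using *(3) by (auto simp: adjoin_def E_eq[OF *(1)] E_eq[OF *(2)])
      qed
    qed
    show "(\<lambda>\<chi>. \<chi> a) ` E = {z. z ^ ?m = c}"
    proof (intro equalityI subsetI)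
      fix z assume "z \<in> (\<lambda>\<chi>. \<chi> a) ` E"
      then obtain \<chi> where \<chi>: "\<chi> \<in> E" "z = \<chi> a" by blast
      have "\<chi> (a [^] ?m) = \<psi> (a [^] ?m)" using \<chi> m by (auto simp: E_def)
      then show "z \<in> {z. z ^ ?m = c}" using \<chi> pwK[OF K(3)] by (simp add: c_def)
    next
      fix z assume "z \<in> {z. z ^ ?m = c}"
      then have z: "z ^ ?m = c" by simp
      have "c \<noteq> 0" using \<psi> m by (auto simp: c_def dual_group_subgroup_iff)
      then have z0: "z \<noteq> 0" using z m by auto
      \<comment> \<open>the value prescribed at an element does not depend on its representation\<close>
      have wd1: "\<psi> h * z ^ i = \<psi> h' * z ^ j"
        if *: "h \<in> H" "h' \<in> H" "h \<otimes> a [^] i = h' \<otimes> a [^] j" "i \<le> j" for h h' and i j :: nat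
      proof -
        obtain q where q: "j = i + ?m * q" "h = h' \<otimes> (a [^] ?m) [^] q"
          using adjoin_eq_imp[OF assms(1-3) *] by blast
        have "\<psi> h = \<psi> h' * c ^ q"
          using * q pw pwH[OF m(2)] by (simp add: \<psi>_mult c_def)
        then show ?thesis using q z by (simp add: power_add power_mult)
      qed
      have wd: "\<psi> h * z ^ i = \<psi> h' * z ^ j"
        if *: "h \<in> H" "h' \<in> H" "h \<otimes> a [^] i = h' \<otimes> a [^] j" for h h' and i j :: nat
        using wd1[of h h' i j] wd1[of h' h j i] * by (cases "i \<le> j") auto
      define \<chi> where
        "\<chi> = (\<lambda>x\<in>?K. case (SOME (h, i::nat). h \<in> H \<and> x = h \<otimes> a [^] i) of (h, i) \<Rightarrow> \<psi> h * z ^ i)"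
      have \<chi>: "\<chi> (h \<otimes> a [^] i) = \<psi> h * z ^ i" if h: "h \<in> H" for h and i :: nat
      proof -
        let ?P = "\<lambda>(h', j::nat). h' \<in> H \<and> h \<otimes> a [^] i = h' \<otimes> a [^] j"
        have "?P (Eps ?P)" by (rule someI[of ?P "(h, i)"]) (use h in simp)
        then obtain h' j where eps: "Eps ?P = (h', j)" "h' \<in> H" "h \<otimes> a [^] i = h' \<otimes> a [^] j"
          by (auto split: prod.splits)
        have "\<chi> (h \<otimes> a [^] i) = \<psi> h' * z ^ j"
          unfolding \<chi>_def using adjoinI[OF h, of a i] eps(1) by simp
        then show ?thesis using wd[OF h eps(2,3)] by simp
      qed
      have \<psi>1: "\<psi> \<one> = 1" using GH.character_one[OF \<psi>] by simp
      have \<chi>_H: "\<chi> h = \<psi> h" if "h \<in> H" for h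
        using \<chi>[OF that, of 0] that H by simp
      have "\<chi> a = z"
        using \<chi>[of \<one> 1] H \<psi>1 assms(3) by simp
      moreover have "\<chi> \<in> E"
        unfolding E_def dual_group_subgroup_iff mem_Collect_eq
      proof (intro conjI ballI)
        show "\<chi> \<in> extensional ?K" by (simp add: \<chi>_def)
        show "restrict \<chi> H = \<psi>"
          using \<psi> \<chi>_H by (intro extensionalityI[where A = H]) (auto simp: dual_group_subgroup_iff)
        fix x assume "x \<in> ?K"
        then obtain h and i :: nat where x: "x = h \<otimes> a [^] i" "h \<in> H" by (auto simp: adjoin_def)
        show "\<chi> x \<noteq> 0" using x \<chi> z0 \<psi> by (auto simp: dual_group_subgroup_iff)
        fix y assume "y \<in> ?K"
        then obtain h' and j :: nat where y: "y = h' \<otimes> a [^] j" "h' \<in> H" by (auto simp: adjoin_def)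
        show "\<chi> (x \<otimes> y) = \<chi> x * \<chi> y"
          using x y H adjoin_mult[OF assms(2,3) x(2) y(2)] by (simp add: \<chi> \<psi>_mult power_add)
      qed
      ultimately show "z \<in> (\<lambda>\<chi>. \<chi> a) ` E" by blast
    qed
  qed
  then have "card E = card {z. z ^ ?m = c}" by (rule bij_betw_same_card)
  moreover have "c \<noteq> 0" using \<psi> m by (auto simp: c_def dual_group_subgroup_iff)
  ultimately show ?thesis
    using m(1) by (simp add: E_def card_nth_roots)
qed

text \<open>
  Each \<open>\<psi>\<close> has \<open>[G : H]\<close> extensions to \<open>G\<close>: adjoin an element \<open>a\<close> outside \<open>H\<close> to obtain \<open>K\<close>.
  There are \<open>[K : H]\<close> extensions of \<open>\<psi>\<close> to \<open>K\<close>, and by induction each of them has \<open>[G : K]\<close>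
  extensions to \<open>G\<close>. The count is stated as a product to avoid division.
\<close>

lemma (in comm_group) card_extensions:
  assumes "finite (carrier G)" "subgroup H G" "\<psi> \<in> dual_group (G\<lparr>carrier := H\<rparr>)"
  shows "card {\<chi> \<in> dual_group G. restrict \<chi> H = \<psi>} * card H = card (carrier G)"
  using assms(2,3)
proof (induction "card (carrier G) - card H" arbitrary: H \<psi> rule: less_induct)
  case less
  have HG: "H \<subseteq> carrier G" by (rule subgroup.subset[OF less.prems(1)])
  show ?case
  proof (cases "H = carrier G")
    case True
    then have "{\<chi> \<in> dual_group G. restrict \<chi> H = \<psi>} = {\<psi>}"
      using less.prems(2) by (auto simp: dual_group_def extensional_restrict)
    then show ?thesis using True by simp
  next
    case False
    then obtain a where a: "a \<in> carrier G" "a \<notin> H" using HG by blast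
    let ?K = "adjoin H a"
    let ?E = "{\<phi> \<in> dual_group (G\<lparr>carrier := ?K\<rparr>). restrict \<phi> H = \<psi>}"
    note K = adjoin_subgroup[OF assms(1) less.prems(1) a(1)]
    have KG: "?K \<subseteq> carrier G" by (rule subgroup.subset[OF K(1)])
    have finK: "finite ?K" using KG assms(1) finite_subset by blast
    have "H \<subset> ?K" using K a by blast
    then have "card H < card ?K" using finK by (rule psubset_card_mono[rotated])
    moreover have "card ?K \<le> card (carrier G)" using KG assms(1) by (rule card_mono[rotated])
    ultimately have less': "card (carrier G) - card ?K < card (carrier G) - card H" by linarith
    have cE: "card ?E = rel_order H a"
      by (rule card_extensions_adjoin[OF assms(1) less.prems(1) a(1) less.prems(2)])
    then have finE: "finite ?E"
      using rel_order(1)[OF assms(1) less.prems(1) a(1)] by (intro card_ge_0_finite) simp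
    have cK: "card {\<chi> \<in> dual_group G. restrict \<chi> ?K = \<phi>} * card ?K = card (carrier G)"
      if "\<phi> \<in> ?E" for \<phi>
      using less.hyps[OF less' K(1)] that by blast
    have Kpos: "card ?K > 0" using finK K by (auto simp: card_gt_0_iff)
    have Gpos: "card (carrier G) > 0" using assms(1) by (auto simp: card_gt_0_iff)
    have fin: "finite {\<chi> \<in> dual_group G. restrict \<chi> ?K = \<phi>}" if "\<phi> \<in> ?E" for \<phi>
      using cK[OF that] Gpos by (intro card_ge_0_finite) (metis gr0I mult_0 less_irrefl)
    have restr: "restrict \<chi> H = restrict (restrict \<chi> ?K) H" for \<chi> :: "'a \<Rightarrow> complex"
      using K(2) by (simp add: Int_absorb1)
    have "{\<chi> \<in> dual_group G. restrict \<chi> H = \<psi>}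
        = (\<Union>\<phi>\<in>?E. {\<chi> \<in> dual_group G. restrict \<chi> ?K = \<phi>})" (is "?L = ?R")
    proof
      show "?L \<subseteq> ?R" using character_restrict[OF K(1)] restr by fastforce
      show "?R \<subseteq> ?L" using restr by fastforce
    qed
    then have "card ?L = card ?R" by simp
    also have "\<dots> = (\<Sum>\<phi>\<in>?E. card {\<chi> \<in> dual_group G. restrict \<chi> ?K = \<phi>})"
    proof (rule card_UN_disjoint[OF finE])
      show "\<forall>\<phi>\<in>?E. finite {\<chi> \<in> dual_group G. restrict \<chi> ?K = \<phi>}"
        using fin by (rule ballI)
    qed auto
    also have "\<dots> = (\<Sum>\<phi>\<in>?E. card (carrier G) div card ?K)"
    proof (rule sum.cong[OF refl])
      fix \<phi> assume "\<phi> \<in> ?E"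
      show "card {\<chi> \<in> dual_group G. restrict \<chi> ?K = \<phi>} = card (carrier G) div card ?K"
        unfolding cK[OF \<open>\<phi> \<in> ?E\<close>, symmetric]
        by (rule nonzero_mult_div_cancel_right[symmetric]) (use Kpos in simp)
    qed
    also have "\<dots> = card ?E * (card (carrier G) div card ?K)" by simp
    finally have "card {\<chi> \<in> dual_group G. restrict \<chi> H = \<psi>} * card H
        = (card (carrier G) div card ?K) * card ?K"
      using cE card_adjoin[OF assms(1) less.prems(1) a(1)] by (metis mult.assoc mult.commute)
    also have "\<dots> = card (carrier G)"
    proof -
      have "card ?K dvd card (carrier G)"
        using lagrange[OF K(1)] by (metis dvd_triv_right Coset.order_def)
      then show ?thesis by simp
    qed
    finally show ?thesis .
  qed
qed

lemma (in comm_group) card_dual_group: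
  assumes "finite (carrier G)"
  shows "card (dual_group G) = card (carrier G)"
proof -
  \<comment> \<open>every character of \<open>G\<close> extends the only character of the trivial subgroup\<close>
  define \<epsilon> :: "'a \<Rightarrow> complex" where "\<epsilon> = (\<lambda>x\<in>{\<one>}. 1)"
  have "\<epsilon> \<in> dual_group (G\<lparr>carrier := {\<one>}\<rparr>)"
    by (auto simp: \<epsilon>_def dual_group_subgroup_iff)
  then have "card {\<chi> \<in> dual_group G. restrict \<chi> {\<one>} = \<epsilon>} * card {\<one>} = card (carrier G)"
    by (rule card_extensions[OF assms triv_subgroup])
  moreover have "{\<chi> \<in> dual_group G. restrict \<chi> {\<one>} = \<epsilon>} = dual_group G"
    using character_one by (auto simp: \<epsilon>_def fun_eq_iff)
  ultimately show ?thesis by simp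
qed

lemma (in comm_group) finite_dual_group:
  assumes "finite (carrier G)"
  shows "finite (dual_group G)"
  using card_dual_group[OF assms] assms by (intro card_ge_0_finite) (auto simp: card_gt_0_iff)

lemma (in comm_group) subgroup_character_orthogonality:
  assumes "finite (carrier G)" "subgroup H G"
    "\<chi> \<in> dual_group (G\<lparr>carrier := H\<rparr>)" "\<psi> \<in> dual_group (G\<lparr>carrier := H\<rparr>)"
  shows "(\<Sum>h\<in>H. \<chi> h * \<psi> (inv h)) = (if \<chi> = \<psi> then of_nat (card H) else 0)"
proof -
  interpret GH: group "G\<lparr>carrier := H\<rparr>"
    using assms(2) by (rule subgroup.subgroup_is_group) (rule group_axioms)
  have "finite H" using assms(1) subgroup.subset[OF assms(2)] finite_subset by blast
  then have "(\<Sum>h\<in>H. \<chi> h * \<psi> (inv\<^bsub>G\<lparr>carrier := H\<rparr>\<^esub> h)) = (if \<chi> = \<psi> then of_nat (card H) else 0)"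
    using GH.character_orthogonality[OF _ assms(3,4)] by simp
  then show ?thesis
    using m_inv_consistent[OF assms(2)] by (simp cong: sum.cong)
qed

section \<open>Homogeneous polynomials and a specialisation\<close>

lemma Const_0: "Const 0 = 0"
  by (simp add: Const_def)

lemma Const_1: "Const 1 = 1"
  by (simp add: Const_def)

lemma Const_mult: "Const (c * d) = Const c * Const d"
  by (simp add: Const_def mult_single)

lemma Const_add: "Const (c + d) = Const c + Const d"
  by (simp add: Const_def single_add)

lemma Const_sum: "Const (sum f S) = (\<Sum>x\<in>S. Const (f x))"
  by (induction S rule: infinite_finite_induct) (auto simp: Const_0 Const_add)

lemma keys_add_nat:
  fixes m n :: "'x \<Rightarrow>\<^sub>0 nat"
  shows "Poly_Mapping.keys (m + n) = Poly_Mapping.keys m \<union> Poly_Mapping.keys n"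
  by (auto simp: in_keys_iff lookup_add)

lemma monom_degree_add: "monom_degree (m + n) = monom_degree m + monom_degree n"
proof -
  let ?S = "Poly_Mapping.keys m \<union> Poly_Mapping.keys n"
  have *: "monom_degree k = (\<Sum>x\<in>?S. Poly_Mapping.lookup k x)" if "Poly_Mapping.keys k \<subseteq> ?S" for k
    unfolding monom_degree_def using that
    by (intro sum.mono_neutral_left) (auto simp: in_keys_iff)
  show ?thesis
    by (simp add: * keys_add_nat lookup_add sum.distrib)
qed

text \<open>
  Unlike \<open>homogeneous\<close>, this fixes the degree, so that it is closed under sums; the zero polynomial
  is a form of every degree.
\<close>

definition forms :: "'x set \<Rightarrow> nat \<Rightarrow> 'x cpoly set" where
  "forms X d = {p. \<forall>m \<in> Poly_Mapping.keys p. Poly_Mapping.keys m \<subseteq> X \<and> monom_degree m = d}"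

lemma forms_Var: "x \<in> X \<Longrightarrow> Var x \<in> forms X 1"
  by (auto simp: forms_def Var_def monom_degree_def split: if_splits)

lemma forms_Const: "Const c \<in> forms X 0"
  by (auto simp: forms_def Const_def monom_degree_def split: if_splits)

lemma forms_sum: "(\<And>i. i \<in> I \<Longrightarrow> f i \<in> forms X d) \<Longrightarrow> sum f I \<in> forms X d"
  using keys_sum[of f I] unfolding forms_def by blast

lemma forms_mult:
  assumes "p \<in> forms X d" "q \<in> forms X e"
  shows "p * q \<in> forms X (d + e)"
proof -
  have "Poly_Mapping.keys m \<subseteq> X \<and> monom_degree m = d + e"
    if m: "m \<in> Poly_Mapping.keys (p * q)" for m
  proof -
    obtain a b where "m = a + b" "a \<in> Poly_Mapping.keys p" "b \<in> Poly_Mapping.keys q"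
      using keys_mult[of p q] m by blast
    then show ?thesis
      using assms by (auto simp: forms_def keys_add_nat monom_degree_add)
  qed
  then show ?thesis by (simp add: forms_def)
qed

lemma forms_Const_mult: "p \<in> forms X d \<Longrightarrow> Const c * p \<in> forms X d"
  using forms_mult[OF forms_Const[of c X], of p d] by simp

lemma forms_prod:
  "(\<And>i. i \<in> I \<Longrightarrow> f i \<in> forms X 1) \<Longrightarrow> prod f I \<in> forms X (card I)"
proof (induction I rule: infinite_finite_induct)
  case (insert i I)
  then show ?case using forms_mult[of "f i" X 1 "prod f I" "card I"] by simp
qed (use forms_Const[of 1 X] in \<open>simp_all add: Const_1\<close>)

lemma forms_nonzero:
  assumes "p \<in> forms X d" "p \<noteq> 0"
  shows "p \<in> poly_ring X" "homogeneous p" "total_degree p = d"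
proof -
  show "p \<in> poly_ring X" "homogeneous p"
    using assms by (auto simp: forms_def poly_ring_def homogeneous_def)
  obtain m where "m \<in> Poly_Mapping.keys p"
    using assms(2) by (metis in_keys_iff lookup_zero poly_mapping_eqI)
  then have "monom_degree ` Poly_Mapping.keys p = {d}"
    using assms(1) by (auto simp: forms_def)
  then show "total_degree p = d" by (simp add: total_degree_def)
qed

text \<open>
  The value of \<open>p\<close> at the indicator function of \<open>S\<close>: a monomial takes the value \<open>1\<close> if all of its
  variables lie in \<open>S\<close>, and \<open>0\<close> otherwise. It serves as a ring homomorphism that detects nonzero
  polynomials.
\<close>

definition eval_indicator :: "'x set \<Rightarrow> 'x cpoly \<Rightarrow> complex" where
  "eval_indicator S p =
     (\<Sum>m\<in>Poly_Mapping.keys p. Poly_Mapping.lookup p m * of_bool (Poly_Mapping.keys m \<subseteq> S))"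

lemma eval_indicator_superset:
  assumes "finite M" "Poly_Mapping.keys p \<subseteq> M"
  shows "eval_indicator S p =
    (\<Sum>m\<in>M. Poly_Mapping.lookup p m * of_bool (Poly_Mapping.keys m \<subseteq> S))"
  unfolding eval_indicator_def using assms
  by (intro sum.mono_neutral_left) (auto simp: in_keys_iff)

lemma eval_indicator_0: "eval_indicator S 0 = 0"
  by (simp add: eval_indicator_def)

lemma eval_indicator_single:
  "eval_indicator S (Poly_Mapping.single m c) = c * of_bool (Poly_Mapping.keys m \<subseteq> S)"
  by (simp add: eval_indicator_def)

lemma eval_indicator_add: "eval_indicator S (p + q) = eval_indicator S p + eval_indicator S q"
proof -
  let ?M = "Poly_Mapping.keys p \<union> Poly_Mapping.keys q"
  have "Poly_Mapping.keys (p + q) \<subseteq> ?M" by (rule keys_add)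
  then show ?thesis
    by (simp add: eval_indicator_superset[of ?M] lookup_add ring_distribs sum.distrib)
qed

lemma eval_indicator_sum: "eval_indicator S (sum f I) = (\<Sum>i\<in>I. eval_indicator S (f i))"
  by (induction I rule: infinite_finite_induct) (auto simp: eval_indicator_0 eval_indicator_add)

lemma poly_mapping_sum_single:
  "p = (\<Sum>m\<in>Poly_Mapping.keys p. Poly_Mapping.single m (Poly_Mapping.lookup p m))"
  by (rule poly_mapping_eqI) (auto simp: lookup_sum lookup_single when_def in_keys_iff)

text \<open>
  By bilinearity it is enough to multiply two monomials, and the variables of a product of monomials
  are those of the factors taken together.
\<close>

lemma eval_indicator_mult: "eval_indicator S (p * q) = eval_indicator S p * eval_indicator S q"
proof -
  let ?s = "\<lambda>p m. Poly_Mapping.single m (Poly_Mapping.lookup p m)"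
  have single: "eval_indicator S (?s p m * ?s q n) = eval_indicator S (?s p m) * eval_indicator S (?s q n)" for m n
    by (simp add: mult_single eval_indicator_single keys_add_nat)
  have "p * q = (\<Sum>m\<in>Poly_Mapping.keys p. \<Sum>n\<in>Poly_Mapping.keys q. ?s p m * ?s q n)"
    by (subst poly_mapping_sum_single[of p], subst poly_mapping_sum_single[of q]) (rule sum_product)
  then have "eval_indicator S (p * q) = (\<Sum>m\<in>Poly_Mapping.keys p. eval_indicator S (?s p m)) *
      (\<Sum>n\<in>Poly_Mapping.keys q. eval_indicator S (?s q n))"
    by (simp add: eval_indicator_sum single sum_product)
  then show ?thesis
    by (simp flip: eval_indicator_sum poly_mapping_sum_single)
qed

lemma eval_indicator_Const: "eval_indicator S (Const c) = c"
  by (simp add: Const_def eval_indicator_single)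

lemma eval_indicator_Var: "eval_indicator S (Var x) = of_bool (x \<in> S)"
  by (simp add: Var_def eval_indicator_single)

lemma eval_indicator_prod: "eval_indicator S (prod f I) = (\<Prod>i\<in>I. eval_indicator S (f i))"
  by (induction I rule: infinite_finite_induct)
    (auto simp: eval_indicator_mult eval_indicator_Const simp flip: Const_1)

section \<open>Dedekind's factorisation of the group determinant\<close>

lemma det_mat_diag: "det (mat_diag n f) = (\<Prod>i<n. f i)"
proof -
  have "det (mat_diag n f) = prod_list (diag_mat (mat_diag n f))"
    by (rule det_upper_triangular[of _ n]) (auto simp: mat_diag_def)
  also have "diag_mat (mat_diag n f) = map f [0..<n]"
    by (auto simp: diag_mat_def mat_diag_def)
  also have "prod_list (map f [0..<n]) = (\<Prod>i<n. f i)"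
    by (subst prod.distinct_set_conv_list[symmetric]) (auto simp: lessThan_atLeast0)
  finally show ?thesis .
qed

definition linear_factor :: "('a, 'b) monoid_scheme \<Rightarrow> ('a \<Rightarrow> complex) \<Rightarrow> 'a cpoly" where
  "linear_factor G \<chi> = (\<Sum>g\<in>carrier G. Const (\<chi> g) * Var g)"

text \<open>
  The values of \<open>\<chi>\<close> form a left eigenvector of the group matrix: replace \<open>g\<close> by \<open>g \<otimes> h\<close> in the sum.
\<close>

lemma (in group) character_eigenvector:
  assumes "\<chi> \<in> dual_group G" "h \<in> carrier G"
  shows "(\<Sum>g\<in>carrier G. Const (\<chi> g) * Var (g \<otimes> inv h)) = linear_factor G \<chi> * Const (\<chi> h)"
proof -
  have bij: "bij_betw (\<lambda>g. g \<otimes> h) (carrier G) (carrier G)"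
    using assms(2) by (intro bij_betwI[where g = "\<lambda>g. g \<otimes> inv h"]) (auto simp: m_assoc)
  have "(\<Sum>g\<in>carrier G. Const (\<chi> g) * Var (g \<otimes> inv h))
      = (\<Sum>g\<in>carrier G. Const (\<chi> (g \<otimes> h)) * Var (g \<otimes> h \<otimes> inv h))"
    by (rule sum.reindex_bij_betw[OF bij, symmetric])
  also have "\<dots> = (\<Sum>g\<in>carrier G. Const (\<chi> g) * Var g * Const (\<chi> h))"
    using assms by (intro sum.cong) (auto simp: dual_group_iff m_assoc Const_mult mult_ac)
  finally show ?thesis by (simp add: linear_factor_def sum_distrib_right)
qed

text \<open>
  Let \<open>F\<close> be the character table, \<open>X\<close> the group matrix and \<open>D\<close> the diagonal matrix of the linear
  factors. The eigenvector property says \<open>F X = D F\<close>. The determinant of \<open>F\<close> can be cancelled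
  without appealing to the absence of zero divisors among polynomials: orthogonality gives an
  explicit matrix \<open>F'\<close> with \<open>F F' = |G| I\<close>, so \<open>det F\<close> is a unit.
\<close>

theorem (in comm_group) dedekind_group_det:
  assumes fin: "finite (carrier G)"
  shows "group_det G = (\<Prod>\<chi>\<in>dual_group G. linear_factor G \<chi>)"
proof -
  obtain gs where gs: "distinct gs" "set gs = carrier G"
    using fin finite_distinct_list by blast
  obtain cs where cs: "distinct cs" "set cs = dual_group G"
    using finite_dual_group[OF fin] finite_distinct_list by blast
  define n where "n = length gs"
  have len: "length cs = n"
    using card_dual_group[OF fin] gs cs distinct_card[of gs] distinct_card[of cs] by (simp add: n_def)
  have n: "card (carrier G) = n" using gs distinct_card[of gs] by (simp add: n_def)
  have n0: "n > 0" using n fin one_closed by (metis card_gt_0_iff empty_iff)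
  have gsG: "gs ! i \<in> carrier G" if "i < n" for i using that gs nth_mem n_def by blast
  have csG: "cs ! i \<in> dual_group G" if "i < n" for i using that cs nth_mem len by blast
  have sum_gs: "(\<Sum>k\<in>{0..<n}. f (gs ! k)) = sum f (carrier G)" for f :: "'a \<Rightarrow> 'a cpoly"
    by (rule sum.reindex_bij_betw)
      (use gs n_def in \<open>simp add: bij_betw_nth lessThan_atLeast0[symmetric]\<close>)
  define F where "F = mat n n (\<lambda>(i, j). Const ((cs ! i) (gs ! j)) :: 'a cpoly)"
  define F' where "F' = mat n n (\<lambda>(i, j). Const ((cs ! j) (inv (gs ! i))) :: 'a cpoly)"
  define X where "X = group_matrix G gs"
  define D where "D = mat_diag n (\<lambda>i. linear_factor G (cs ! i))"
  have carr: "F \<in> carrier_mat n n" "F' \<in> carrier_mat n n" "X \<in> carrier_mat n n" "D \<in> carrier_mat n n"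
    by (auto simp: F_def F'_def X_def D_def group_matrix_def n_def)
  have "F * X = D * F"
  proof (rule eq_matI)
    fix i j assume "i < dim_row (D * F)" "j < dim_col (D * F)"
    then have ij: "i < n" "j < n" using carr by auto
    have "(F * X) $$ (i, j)
        = (\<Sum>k\<in>{0..<n}. Const ((cs ! i) (gs ! k)) * Var (gs ! k \<otimes> inv (gs ! j)))"
      using ij by (simp add: F_def X_def group_matrix_def n_def scalar_prod_def)
    also have "\<dots> = (\<Sum>g\<in>carrier G. Const ((cs ! i) g) * Var (g \<otimes> inv (gs ! j)))"
      by (rule sum_gs)
    also have "\<dots> = linear_factor G (cs ! i) * Const ((cs ! i) (gs ! j))"
      by (rule character_eigenvector) (use ij gsG csG in auto)
    also have "\<dots> = (D * F) $$ (i, j)"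
      unfolding D_def mat_diag_mult_left[OF carr(1)] using ij by (simp add: F_def)
    finally show "(F * X) $$ (i, j) = (D * F) $$ (i, j)" .
  qed (use carr in auto)
  then have det1: "det F * det X = det D * det F"
    using det_mult[OF carr(1,3)] det_mult[OF carr(4,1)] by simp
  have "F * F' = mat_diag n (\<lambda>_. Const (of_nat n))"
  proof (rule eq_matI)
    fix i j assume "i < dim_row (mat_diag n (\<lambda>_. Const (of_nat n) :: 'a cpoly))"
      "j < dim_col (mat_diag n (\<lambda>_. Const (of_nat n) :: 'a cpoly))"
    then have ij: "i < n" "j < n" by (auto simp: mat_diag_def)
    have "(F * F') $$ (i, j)
        = (\<Sum>k\<in>{0..<n}. Const ((cs ! i) (gs ! k)) * Const ((cs ! j) (inv (gs ! k))))"
      using ij by (simp add: F_def F'_def scalar_prod_def)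
    also have "\<dots> = (\<Sum>g\<in>carrier G. Const ((cs ! i) g) * Const ((cs ! j) (inv g)))"
      by (rule sum_gs)
    also have "\<dots> = Const (\<Sum>g\<in>carrier G. (cs ! i) g * (cs ! j) (inv g))"
      by (simp add: Const_sum Const_mult)
    also have "\<dots> = Const (if cs ! i = cs ! j then of_nat n else 0)"
      using character_orthogonality[OF fin csG[OF ij(1)] csG[OF ij(2)]] n by simp
    also have "\<dots> = mat_diag n (\<lambda>_. Const (of_nat n)) $$ (i, j)"
      using ij cs(1) len by (simp add: mat_diag_def nth_eq_iff_index_eq Const_0)
    finally show "(F * F') $$ (i, j) = mat_diag n (\<lambda>_. Const (of_nat n)) $$ (i, j)" .
  qed (use carr in \<open>auto simp: mat_diag_def\<close>)
  then have "det F * det F' = Const (of_nat n) ^ n"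
    using det_mult[OF carr(1,2)] by (simp add: det_mat_diag)
  then have "det F * det F' * Const (1 / of_nat n) ^ n = (Const (of_nat n) * Const (1 / of_nat n)) ^ n"
    by (simp add: power_mult_distrib)
  also have "\<dots> = 1"
    using n0 by (simp add: Const_mult[symmetric] Const_1)
  finally have unit: "det F * (det F' * Const (1 / of_nat n) ^ n) = 1" by (simp add: mult_ac)
  have "det X = det F * (det F' * Const (1 / of_nat n) ^ n) * det X" by (simp only: unit mult_1_left)
  also have "\<dots> = (det F * det X) * (det F' * Const (1 / of_nat n) ^ n)" by (simp only: mult_ac)
  also have "\<dots> = det D * (det F * (det F' * Const (1 / of_nat n) ^ n))"
    by (simp only: det1 mult.assoc)
  also have "\<dots> = det D" by (simp only: unit mult_1_right)
  also have "det D = (\<Prod>i<n. linear_factor G (cs ! i))" by (simp add: D_def det_mat_diag)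
  also have "\<dots> = (\<Prod>\<chi>\<in>dual_group G. linear_factor G \<chi>)"
    by (rule prod.reindex_bij_betw) (use cs len in \<open>simp add: bij_betw_nth\<close>)
  finally show ?thesis
    using group_det_eq[OF gs] by (simp add: X_def)
qed

section \<open>Relative factors over a subgroup\<close>

definition relative_factor ::
    "('a, 'b) monoid_scheme \<Rightarrow> 'a set \<Rightarrow> ('a \<Rightarrow> complex) \<Rightarrow> 'a cpoly" where
  "relative_factor G H \<psi> = (\<Prod>\<chi> | \<chi> \<in> dual_group G \<and> restrict \<chi> H = \<psi>. linear_factor G \<chi>)"

text \<open>
  The inverse Fourier transform over \<open>H\<close> of the family of relative factors.
\<close>

definition relative_coeff :: "('a, 'b) monoid_scheme \<Rightarrow> 'a set \<Rightarrow> 'a \<Rightarrow> 'a cpoly" where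
  "relative_coeff G H h = (\<Sum>\<psi>\<in>dual_group (G\<lparr>carrier := H\<rparr>).
     Const (\<psi> (inv\<^bsub>G\<^esub> h) / of_nat (card H)) * relative_factor G H \<psi>)"

lemma (in comm_group) finite_dual_subgroup:
  assumes "finite (carrier G)" "subgroup H G"
  shows "finite (dual_group (G\<lparr>carrier := H\<rparr>))"
proof -
  interpret GH: comm_group "G\<lparr>carrier := H\<rparr>"
    by (rule group.group_comm_groupI[OF subgroup.subgroup_is_group[OF assms(2) group_axioms]])
      (use subgroup.mem_carrier[OF assms(2)] m_comm in auto)
  show ?thesis
    using GH.finite_dual_group assms(1) finite_subset[OF subgroup.subset[OF assms(2)]] by simp
qed

lemma (in comm_group) group_det_relative:
  assumes "finite (carrier G)" "subgroup H G"
  shows "group_det G = (\<Prod>\<psi>\<in>dual_group (G\<lparr>carrier := H\<rparr>). relative_factor G H \<psi>)"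
  unfolding dedekind_group_det[OF assms(1)] relative_factor_def
  using character_restrict[OF assms(2)]
  by (intro prod.group[symmetric] finite_dual_group finite_dual_subgroup assms) auto

text \<open>
  Fourier inversion on \<open>H\<close>: after exchanging the sums, orthogonality leaves only the term of \<open>\<chi>\<close>.
\<close>

lemma (in comm_group) relative_factor_expansion:
  assumes "finite (carrier G)" "subgroup H G" "\<chi> \<in> dual_group (G\<lparr>carrier := H\<rparr>)"
  shows "(\<Sum>h\<in>H. Const (\<chi> h) * relative_coeff G H h) = relative_factor G H \<chi>"
proof -
  let ?D = "dual_group (G\<lparr>carrier := H\<rparr>)"
  have "finite H" using assms(1) subgroup.subset[OF assms(2)] finite_subset by blast
  then have H0: "card H \<noteq> 0" using subgroup.one_closed[OF assms(2)] by auto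
  have "(\<Sum>h\<in>H. Const (\<chi> h) * relative_coeff G H h)
      = (\<Sum>\<psi>\<in>?D. \<Sum>h\<in>H. Const (\<chi> h * \<psi> (inv h) / of_nat (card H)) * relative_factor G H \<psi>)"
    unfolding relative_coeff_def sum_distrib_left
    by (subst sum.swap) (simp add: Const_mult[symmetric] mult.assoc[symmetric])
  also have "\<dots> = (\<Sum>\<psi>\<in>?D. Const ((\<Sum>h\<in>H. \<chi> h * \<psi> (inv h)) / of_nat (card H)) * relative_factor G H \<psi>)"
    by (simp add: sum_divide_distrib Const_sum sum_distrib_right)
  also have "\<dots> = (\<Sum>\<psi>\<in>?D. if \<psi> = \<chi> then relative_factor G H \<psi> else 0)"
    using H0 subgroup_character_orthogonality[OF assms]
    by (intro sum.cong) (auto simp: Const_0 Const_1)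
  also have "\<dots> = relative_factor G H \<chi>"
    using finite_dual_subgroup[OF assms(1,2)] assms(3) by simp
  finally show ?thesis .
qed

lemma (in comm_group) card_extensions_index:
  assumes "finite (carrier G)" "subgroup H G" "\<psi> \<in> dual_group (G\<lparr>carrier := H\<rparr>)"
  shows "card {\<chi> \<in> dual_group G. restrict \<chi> H = \<psi>} = card (rcosets H)"
proof -
  have "finite H" using assms(1) subgroup.subset[OF assms(2)] finite_subset by blast
  then have "card H \<noteq> 0" using subgroup.one_closed[OF assms(2)] by auto
  moreover have "card {\<chi> \<in> dual_group G. restrict \<chi> H = \<psi>} * card H = card (rcosets H) * card H"
    using card_extensions[OF assms] lagrange[OF assms(2)] by (simp add: Coset.order_def)
  ultimately show ?thesis by simp
qed

lemma (in comm_group) relative_coeff_forms: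
  assumes "finite (carrier G)" "subgroup H G"
  shows "relative_coeff G H h \<in> forms (carrier G) (card (rcosets H))"
  unfolding relative_coeff_def
proof (intro forms_sum forms_Const_mult)
  fix \<psi> assume \<psi>: "\<psi> \<in> dual_group (G\<lparr>carrier := H\<rparr>)"
  have "relative_factor G H \<psi> \<in> forms (carrier G) (card {\<chi> \<in> dual_group G. restrict \<chi> H = \<psi>})"
    unfolding relative_factor_def linear_factor_def
    by (intro forms_prod forms_sum forms_Const_mult forms_Var)
  then show "relative_factor G H \<psi> \<in> forms (carrier G) (card (rcosets H))"
    using card_extensions_index[OF assms \<psi>] by simp
qed

text \<open>
  At the indicator function of \<open>H\<close> the factor \<open>relative_factor G H \<psi>\<close> takes the value
  \<open>(\<Sum>h\<in>H. \<psi>(h))\<close> to the power \<open>[G : H]\<close>, because all its linear factors belong to characters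
  agreeing with \<open>\<psi>\<close> on \<open>H\<close>. This vanishes unless \<open>\<psi>\<close> is trivial, so a single positive term is
  left in the sum that defines \<open>relative_coeff G H h\<close>.
\<close>

lemma (in comm_group) relative_coeff_nonzero:
  assumes "finite (carrier G)" "subgroup H G" "h \<in> H"
  shows "relative_coeff G H h \<noteq> 0"
proof -
  let ?D = "dual_group (G\<lparr>carrier := H\<rparr>)" and ?k = "card (rcosets H)"
  define \<epsilon> :: "'a \<Rightarrow> complex" where "\<epsilon> = (\<lambda>x\<in>H. 1)"
  have HG: "H \<subseteq> carrier G" by (rule subgroup.subset[OF assms(2)])
  have "finite H" using assms(1) HG finite_subset by blast
  then have H0: "card H \<noteq> 0" using assms(3) by auto
  have invH: "inv x \<in> H" if "x \<in> H" for x by (rule subgroup.m_inv_closed[OF assms(2) that])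
  have \<epsilon>: "\<epsilon> \<in> ?D"
    using subgroup.m_closed[OF assms(2)] by (auto simp: \<epsilon>_def dual_group_subgroup_iff)
  \<comment> \<open>a positive exponent, so that a vanishing base gives a vanishing power\<close>
  have k0: "?k > 0"
    using lagrange[OF assms(2)] assms(1) order_gt_0_iff_finite by (metis gr0I mult_0 less_irrefl)
  have sumH: "(\<Sum>h\<in>H. \<psi> h) = (if \<psi> = \<epsilon> then of_nat (card H) else 0)" if "\<psi> \<in> ?D" for \<psi>
    using subgroup_character_orthogonality[OF assms(1,2) that \<epsilon>] invH by (simp add: \<epsilon>_def cong: sum.cong)
  have lin: "eval_indicator H (linear_factor G \<chi>) = (\<Sum>h\<in>H. \<chi> h)" for \<chi>
  proof -
    have "eval_indicator H (linear_factor G \<chi>) = (\<Sum>g\<in>carrier G. \<chi> g * of_bool (g \<in> H))"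
      by (simp add: linear_factor_def eval_indicator_sum eval_indicator_mult eval_indicator_Const
          eval_indicator_Var)
    also have "\<dots> = (\<Sum>h\<in>H. \<chi> h)"
      using HG assms(1) by (intro sum.mono_neutral_cong_right) auto
    finally show ?thesis .
  qed
  have rel: "eval_indicator H (relative_factor G H \<psi>) = (if \<psi> = \<epsilon> then of_nat (card H) ^ ?k else 0)"
    if "\<psi> \<in> ?D" for \<psi>
  proof -
    have "(\<Sum>h\<in>H. \<chi> h) = (\<Sum>h\<in>H. \<psi> h)" if "restrict \<chi> H = \<psi>" for \<chi> :: "'a \<Rightarrow> complex"
      using that by (intro sum.cong) auto
    then have "eval_indicator H (relative_factor G H \<psi>) = (\<Sum>h\<in>H. \<psi> h) ^ ?k"
      using card_extensions_index[OF assms(1,2) that]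
      by (simp add: relative_factor_def eval_indicator_prod lin)
    then show ?thesis using sumH[OF that] k0 by simp
  qed
  have "eval_indicator H (relative_coeff G H h)
      = (\<Sum>\<psi>\<in>?D. if \<psi> = \<epsilon> then \<psi> (inv h) / of_nat (card H) * of_nat (card H) ^ ?k else 0)"
    unfolding relative_coeff_def
    by (simp add: eval_indicator_sum eval_indicator_mult eval_indicator_Const rel if_distrib cong: if_cong sum.cong)
  also have "\<dots> = \<epsilon> (inv h) / of_nat (card H) * of_nat (card H) ^ ?k"
    using finite_dual_subgroup[OF assms(1,2)] \<epsilon> by simp
  also have "\<dots> \<noteq> 0" using H0 invH[OF assms(3)] by (simp add: \<epsilon>_def)
  finally show ?thesis by (auto simp: eval_indicator_0)
qed

lemma Var_nonzero: "Var x \<noteq> 0"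
  using eval_indicator_Var[of UNIV x] eval_indicator_0[of UNIV] by (metis of_bool_eq(2) UNIV_I zero_neq_one)

theorem theorem4:
  fixes G :: "('a, 'b) monoid_scheme" and H :: "'a set"
  assumes "comm_group G" and "finite (carrier G)" and "subgroup H G"
  shows "\<exists>A :: 'a \<Rightarrow> 'a cpoly.
    (\<forall>h \<in> H. A h \<in> poly_ring (carrier G) \<and> homogeneous (A h)
             \<and> total_degree (A h) = card (rcosets\<^bsub>G\<^esub> H))
    \<and> group_det G = (\<Prod>\<chi> \<in> dual_group (G\<lparr>carrier := H\<rparr>). \<Sum>h \<in> H. Const (\<chi> h) * A h)
    \<and> (H = carrier G \<longrightarrow> (\<forall>h \<in> H. A h = Var h))"
proof (cases "H = carrier G")
  case False
  interpret comm_group G by (rule assms(1))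
  have "group_det G = (\<Prod>\<chi>\<in>dual_group (G\<lparr>carrier := H\<rparr>). \<Sum>h\<in>H. Const (\<chi> h) * relative_coeff G H h)"
    using group_det_relative[OF assms(2,3)] relative_factor_expansion[OF assms(2,3)] by simp
  moreover have "relative_coeff G H h \<in> poly_ring (carrier G) \<and> homogeneous (relative_coeff G H h)
      \<and> total_degree (relative_coeff G H h) = card (rcosets\<^bsub>G\<^esub> H)" if "h \<in> H" for h
    using forms_nonzero[OF relative_coeff_forms[OF assms(2,3)] relative_coeff_nonzero[OF assms(2,3) that]]
    by blast
  ultimately show ?thesis
    using False by (intro exI[of _ "relative_coeff G H"]) blast
next
  case True
  interpret comm_group G by (rule assms(1))
  have "card (rcosets\<^bsub>G\<^esub> H) * card H = card H"
    using lagrange[OF assms(3)] True by (simp add: Coset.order_def)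
  moreover have "card H \<noteq> 0" using True assms(2) by auto
  ultimately have "card (rcosets\<^bsub>G\<^esub> H) = 1" by simp
  then have "Var h \<in> poly_ring (carrier G) \<and> homogeneous (Var h)
      \<and> total_degree (Var h) = card (rcosets\<^bsub>G\<^esub> H)" if "h \<in> H" for h
    using forms_nonzero[OF forms_Var Var_nonzero, of h "carrier G"] that True by simp
  moreover have "group_det G = (\<Prod>\<chi>\<in>dual_group (G\<lparr>carrier := H\<rparr>). \<Sum>h\<in>H. Const (\<chi> h) * Var h)"
    using dedekind_group_det[OF assms(2)] True by (simp add: linear_factor_def)
  ultimately show ?thesis by blast
qed

end
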